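(* Let $G=(V,E)$ be a finite simple undirected graph and let $P=\{a_1,\dots,a_k\}\subseteq V$ be such that $G[P]$ is a path graph and $\deg(a)=2$ for all $a\in P$. Let $\Gamma(P)=\{a_0,a_{k+1}\}$ and $\Gamma(a_i)=\{a_{i-1},a_{i+1}\}$ for $i=1,\dots,k$. Then there exists a node ordering $\sigma'=x_1\cdots x_i\,a_1\cdots a_k\,x_{i+1}\cdots x_\ell$ of $G$, where $V\setminus P=\{x_1,\dots,x_\ell\}$, such that $\phi(G,\sigma')=\Phi(G)$.
   Context: $\Gamma(v)$ is the neighborhood of $v$; for $A\subseteq V$, $\Gamma(A)=\left(\bigcup_{x\in A}\Gamma(x)\right)\setminus A$. $G[P]$ is the subgraph induced by $P$. The deficiency of $x$ in $G$ is $D_G(x)=\{\{c,d\}: c,d\in\Gamma_G(x),\ c\neq d,\ \{c,d\}\notin E\}$. Eliminating $x$ gives $G_x=(V\setminus\{x\},\,E(V\setminus\{x\})\cup D_G(x))$, where $E(U)$ denotes the edges with both endpoints in $U$. A node ordering of $G$ with $n=|V|$ is a bijection $\sigma:\{1,\dots,n\}\to V$, written $x_1x_2\cdots x_n$ with $\sigma(j)=x_j$; it defines $G^{(0)}=G$, $G^{(i)}=(G^{(i-1)})_{\sigma(i)}$, and has fill-in $\phi(G,\sigma)=\sum_{i=1}^n|D_{G^{(i-1)}}(\sigma(i))|$. $\Phi(G)=\min_\sigma\phi(G,\sigma)$. *)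

theory Defs
  imports Main "HOL-Library.FuncSet"
begin

type_synonym 'a ugraph = "'a set \<times> 'a set set"

abbreviation verts :: "'a ugraph \<Rightarrow> 'a set" where
  "verts G \<equiv> fst G"

abbreviation edges :: "'a ugraph \<Rightarrow> 'a set set" where
  "edges G \<equiv> snd G"

definition finite_simple_graph :: "'a ugraph \<Rightarrow> bool" where
  "finite_simple_graph G \<longleftrightarrow>
     finite (verts G) \<and> (\<forall>e\<in>edges G. e \<subseteq> verts G \<and> card e = 2)"

definition nbhd :: "'a ugraph \<Rightarrow> 'a \<Rightarrow> 'a set" where
  "nbhd G v = {u. {u, v} \<in> edges G}"

definition nbhd_set :: "'a ugraph \<Rightarrow> 'a set \<Rightarrow> 'a set" where
  "nbhd_set G A = (\<Union>x\<in>A. nbhd G x) - A"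

definition degree :: "'a ugraph \<Rightarrow> 'a \<Rightarrow> nat" where
  "degree G v = card (nbhd G v)"

definition edges_within :: "'a ugraph \<Rightarrow> 'a set \<Rightarrow> 'a set set" where
  "edges_within G U = {e \<in> edges G. e \<subseteq> U}"

definition induced_subgraph :: "'a ugraph \<Rightarrow> 'a set \<Rightarrow> 'a ugraph" where
  "induced_subgraph G P = (P, edges_within G P)"

text \<open>A path graph has at least one vertex; a single vertex without edges counts as a path.\<close>

definition path_graph :: "'a ugraph \<Rightarrow> bool" where
  "path_graph H \<longleftrightarrow>
     (\<exists>m p. m \<ge> (1::nat) \<and> bij_betw p {1..m} (verts H) \<and>
            edges H = {{p j, p (j + 1)} | j. 1 \<le> j \<and> j < m})"

definition deficiency :: "'a ugraph \<Rightarrow> 'a \<Rightarrow> 'a set set" where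
  "deficiency G x =
     {{c, d} | c d. c \<in> nbhd G x \<and> d \<in> nbhd G x \<and> c \<noteq> d \<and> {c, d} \<notin> edges G}"

definition eliminate :: "'a ugraph \<Rightarrow> 'a \<Rightarrow> 'a ugraph" where
  "eliminate G x = (verts G - {x}, edges_within G (verts G - {x}) \<union> deficiency G x)"

text \<open>An ordering is a function on all of \<^typ>\<open>nat\<close>; its values outside \<open>{1..card (verts G)}\<close>
  are irrelevant.\<close>

definition node_ordering :: "'a ugraph \<Rightarrow> (nat \<Rightarrow> 'a) \<Rightarrow> bool" where
  "node_ordering G \<sigma> \<longleftrightarrow> bij_betw \<sigma> {1..card (verts G)} (verts G)"

primrec elim_graph :: "'a ugraph \<Rightarrow> (nat \<Rightarrow> 'a) \<Rightarrow> nat \<Rightarrow> 'a ugraph" where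
  "elim_graph G \<sigma> 0 = G"
| "elim_graph G \<sigma> (Suc i) = eliminate (elim_graph G \<sigma> i) (\<sigma> (Suc i))"

definition fill_in :: "'a ugraph \<Rightarrow> (nat \<Rightarrow> 'a) \<Rightarrow> nat" where
  "fill_in G \<sigma> = (\<Sum>i = 1..card (verts G). card (deficiency (elim_graph G \<sigma> (i - 1)) (\<sigma> i)))"

definition min_fill_in :: "'a ugraph \<Rightarrow> nat" where
  "min_fill_in G = Min {fill_in G \<sigma> | \<sigma>. node_ordering G \<sigma>}"

text \<open>The set under \<^const>\<open>Min\<close> is finite and nonempty, so the minimum is attained.\<close>

lemma elim_graph_cong:
  assumes "\<And>j. 1 \<le> j \<Longrightarrow> j \<le> i \<Longrightarrow> \<sigma> j = \<tau> j"
  shows "elim_graph G \<sigma> i = elim_graph G \<tau> i"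
  using assms by (induction i) auto

lemma fill_in_cong:
  assumes "\<And>j. j \<in> {1..card (verts G)} \<Longrightarrow> \<sigma> j = \<tau> j"
  shows "fill_in G \<sigma> = fill_in G \<tau>"
  unfolding fill_in_def
proof (rule sum.cong[OF refl])
  fix i assume i: "i \<in> {1..card (verts G)}"
  have "elim_graph G \<sigma> (i - 1) = elim_graph G \<tau> (i - 1)"
    using i by (intro elim_graph_cong assms) auto
  then show "card (deficiency (elim_graph G \<sigma> (i - 1)) (\<sigma> i)) =
             card (deficiency (elim_graph G \<tau> (i - 1)) (\<tau> i))"
    using assms[OF i] by simp
qed

lemma finite_fill_ins:
  assumes "finite (verts G)"
  shows "finite {fill_in G \<sigma> | \<sigma>. node_ordering G \<sigma>}"
proof (rule finite_subset)
  let ?I = "{1..card (verts G)}"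
  show "{fill_in G \<sigma> | \<sigma>. node_ordering G \<sigma>} \<subseteq> fill_in G ` (?I \<rightarrow>\<^sub>E verts G)"
  proof clarify
    fix \<sigma> assume "node_ordering G \<sigma>"
    then have "restrict \<sigma> ?I \<in> ?I \<rightarrow>\<^sub>E verts G"
      by (auto simp: node_ordering_def bij_betw_def)
    moreover have "fill_in G \<sigma> = fill_in G (restrict \<sigma> ?I)"
      by (rule fill_in_cong) simp
    ultimately show "fill_in G \<sigma> \<in> fill_in G ` (?I \<rightarrow>\<^sub>E verts G)" by blast
  qed
  show "finite (fill_in G ` (?I \<rightarrow>\<^sub>E verts G))"
    using assms by (intro finite_imageI finite_PiE) auto
qed

lemma min_fill_in_attained:
  assumes "finite (verts G)"
  shows "\<exists>\<sigma>. node_ordering G \<sigma> \<and> fill_in G \<sigma> = min_fill_in G"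
proof -
  obtain \<sigma> where "node_ordering G \<sigma>"
    using assms ex_bij_betw_nat_finite_1 unfolding node_ordering_def by blast
  then have "{fill_in G \<sigma> | \<sigma>. node_ordering G \<sigma>} \<noteq> {}" by blast
  from Min_in[OF finite_fill_ins[OF assms] this] show ?thesis
    unfolding min_fill_in_def by force
qed

lemma min_fill_in_le:
  assumes "finite (verts G)" and "node_ordering G \<sigma>"
  shows "min_fill_in G \<le> fill_in G \<sigma>"
  unfolding min_fill_in_def using assms by (intro Min_le finite_fill_ins) auto

end

theory Submission
  imports Defs
begin

text \<open>
  The minimum fill-in is the least number of edges whose addition makes \<open>G\<close> chordal, that is, gives
  \<open>G\<close> a perfect elimination ordering. By a form of Dirac's theorem, a chordal graph can be
  eliminated perfectly with any prescribed clique coming last. Write \<open>u = a 0\<close> and \<open>w = a (k + 1)\<close>.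

  If \<open>u\<close> and \<open>w\<close> lie in the same component of \<open>G - P\<close>, it is optimal to eliminate \<open>P\<close> first, one
  vertex at a time. A vertex \<open>v\<close> whose two neighbours \<open>u\<close> and \<open>b\<close> are adjacent or equal causes no
  fill-in. Otherwise \<open>uv\<close> is not a bridge, so it lies in a triangle of any optimal triangulation,
  and contracting it gives a chordal graph with at least two edges fewer. That graph contains \<open>G\<close>
  with \<open>v\<close> eliminated, which has just one edge less than \<open>G\<close>; so the fill-in drops by at least one.

  If \<open>u\<close> and \<open>w\<close> lie in different components, let \<open>U\<close> be the one of \<open>u\<close>. Keep of an optimal
  triangulation only the edges of \<open>G\<close> and those within \<open>U\<close> or within \<open>V - P - U\<close>. The result has a
  perfect elimination ordering that runs through \<open>U\<close>, ending with \<open>u\<close>, then through \<open>P\<close>, and then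
  through the rest.
\<close>

section \<open>Simple graphs\<close>

lemma mem_nbhd_iff: "u \<in> nbhd G v \<longleftrightarrow> {u, v} \<in> edges G"
  by (simp add: nbhd_def)

lemma nbhd_commute: "u \<in> nbhd G v \<longleftrightarrow> v \<in> nbhd G u"
  by (simp add: mem_nbhd_iff insert_commute)

lemma nbhd_mono: "edges G \<subseteq> edges H \<Longrightarrow> nbhd G v \<subseteq> nbhd H v"
  by (auto simp: nbhd_def)

lemma edge_endpoints:
  assumes "finite_simple_graph G" "{x, y} \<in> edges G"
  shows "x \<in> verts G" "y \<in> verts G" "x \<noteq> y"
  using assms unfolding finite_simple_graph_def by (force simp: card_insert_if)+

lemma edgeE:
  assumes "finite_simple_graph G" "e \<in> edges G"
  obtains x y where "e = {x, y}" "x \<noteq> y" "x \<in> verts G" "y \<in> verts G"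
proof -
  have "card e = 2" "e \<subseteq> verts G" using assms unfolding finite_simple_graph_def by auto
  then show thesis using that by (auto simp: card_2_iff)
qed

lemma finite_edges: "finite_simple_graph G \<Longrightarrow> finite (edges G)"
  unfolding finite_simple_graph_def
  by (rule finite_subset[of _ "Pow (verts G)"]) auto

lemma finite_nbhd: "finite_simple_graph G \<Longrightarrow> finite (nbhd G v)"
  by (rule finite_subset[of _ "verts G"])
    (auto simp: nbhd_def finite_simple_graph_def)

lemma nbhd_irrefl: "finite_simple_graph G \<Longrightarrow> v \<notin> nbhd G v"
  using edge_endpoints(3)[of G v v] by (auto simp: mem_nbhd_iff)

lemma finite_simple_graph_subgraph:
  assumes "finite_simple_graph H" "V \<subseteq> verts H" "E \<subseteq> edges H" "\<Union>E \<subseteq> V"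
  shows "finite_simple_graph (V, E)"
  using assms finite_subset[of V "verts H"] unfolding finite_simple_graph_def by auto

definition incident_edges :: "'a ugraph \<Rightarrow> 'a \<Rightarrow> 'a set set" where
  "incident_edges G v = {e \<in> edges G. v \<in> e}"

lemma card_incident_edges:
  assumes "finite_simple_graph G"
  shows "card (incident_edges G v) = card (nbhd G v)"
proof -
  have "incident_edges G v = (\<lambda>x. {x, v}) ` nbhd G v"
  proof (intro equalityI subsetI)
    fix e assume e: "e \<in> incident_edges G v"
    then obtain x y where "e = {x, y}"
      using edgeE[OF assms, of e] unfolding incident_edges_def by blast
    then show "e \<in> (\<lambda>x. {x, v}) ` nbhd G v"
      using e by (auto simp: incident_edges_def nbhd_def insert_commute)
  qed (auto simp: incident_edges_def nbhd_def)
  moreover have "inj_on (\<lambda>x. {x, v}) (nbhd G v)"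
    by (auto simp: inj_on_def doubleton_eq_iff)
  ultimately show ?thesis by (simp add: card_image)
qed

lemma card_edges_remove_vertex:
  assumes "finite_simple_graph G"
  shows "card (edges G) = card (edges_within G (verts G - {v})) + card (nbhd G v)"
proof -
  have "edges G = edges_within G (verts G - {v}) \<union> incident_edges G v"
    using assms unfolding finite_simple_graph_def edges_within_def incident_edges_def by auto
  moreover have "edges_within G (verts G - {v}) \<inter> incident_edges G v = {}"
    by (auto simp: edges_within_def incident_edges_def)
  ultimately show ?thesis
    using card_Un_disjoint[of "edges_within G (verts G - {v})" "incident_edges G v"]
      finite_edges[OF assms] card_incident_edges[OF assms, of v] by simp
qed

section \<open>Elimination\<close>

lemma verts_eliminate [simp]: "verts (eliminate G x) = verts G - {x}"
  by (simp add: eliminate_def)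

lemma edges_eliminate:
  "edges (eliminate G x) = edges_within G (verts G - {x}) \<union> deficiency G x"
  by (simp add: eliminate_def)

lemma doubleton_mem_deficiency_iff:
  "{c, d} \<in> deficiency G x \<longleftrightarrow>
     c \<in> nbhd G x \<and> d \<in> nbhd G x \<and> c \<noteq> d \<and> {c, d} \<notin> edges G"
  unfolding deficiency_def by (auto simp: doubleton_eq_iff insert_commute)

lemma nbhd_eliminate:
  assumes "finite_simple_graph G" "y \<noteq> x"
  shows "nbhd (eliminate G x) y =
    nbhd G y - {x} \<union> (if y \<in> nbhd G x then nbhd G x - {y} else {})"
proof (intro set_eqI)
  fix z
  have "{z, y} \<in> edges_within G (verts G - {x}) \<longleftrightarrow> z \<in> nbhd G y - {x}"
    using assms edge_endpoints[OF assms(1), of z y] by (auto simp: edges_within_def mem_nbhd_iff)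
  then show "z \<in> nbhd (eliminate G x) y \<longleftrightarrow>
      z \<in> nbhd G y - {x} \<union> (if y \<in> nbhd G x then nbhd G x - {y} else {})"
    using nbhd_irrefl[OF assms(1)]
    by (auto simp: mem_nbhd_iff[of _ "eliminate G x"] mem_nbhd_iff[of _ G y] edges_eliminate
        doubleton_mem_deficiency_iff)
qed

lemma finite_simple_graph_eliminate:
  assumes "finite_simple_graph G"
  shows "finite_simple_graph (eliminate G x)"
  using assms edge_endpoints[OF assms]
  unfolding finite_simple_graph_def edges_eliminate
  by (auto simp: edges_within_def deficiency_def nbhd_def card_insert_if)

lemma card_edges_eliminate:
  assumes "finite_simple_graph G"
  shows "card (edges (eliminate G x)) + card (nbhd G x) = card (edges G) + card (deficiency G x)"
proof -
  have "finite (edges_within G (verts G - {x}))" "finite (deficiency G x)"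
    using finite_edges[OF finite_simple_graph_eliminate[OF assms]]
    by (simp_all add: edges_eliminate)
  then have "card (edges (eliminate G x)) =
      card (edges_within G (verts G - {x})) + card (deficiency G x)"
    unfolding edges_eliminate
    by (rule card_Un_disjoint) (auto simp: edges_within_def deficiency_def)
  then show ?thesis using card_edges_remove_vertex[OF assms, of x] by simp
qed

subsection \<open>Elimination orderings as lists\<close>

fun fill_list :: "'a ugraph \<Rightarrow> 'a list \<Rightarrow> nat" where
  "fill_list G [] = 0"
| "fill_list G (x # xs) = card (deficiency G x) + fill_list (eliminate G x) xs"

definition list_ordering :: "'a ugraph \<Rightarrow> 'a list \<Rightarrow> bool" where
  "list_ordering G xs \<longleftrightarrow> distinct xs \<and> set xs = verts G"

lemma fill_list_append:
  "fill_list G (xs @ ys) = fill_list G xs + fill_list (foldl eliminate G xs) ys"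
  by (induction xs arbitrary: G) auto

lemma elim_graph_eq_foldl:
  "elim_graph G \<sigma> n = foldl eliminate G (map \<sigma> [1..<Suc n])"
  by (induction n) auto

lemma fill_in_eq_fill_list:
  "fill_in G \<sigma> = fill_list G (map \<sigma> [1..<Suc (card (verts G))])"
proof -
  have "(\<Sum>i = 1..n. card (deficiency (elim_graph G \<sigma> (i - 1)) (\<sigma> i))) =
        fill_list G (map \<sigma> [1..<Suc n])" for n
    by (induction n) (auto simp: fill_list_append elim_graph_eq_foldl)
  then show ?thesis by (simp add: fill_in_def)
qed

declare upt_Suc [simp del]

lemma bij_betw_nth_pred:
  assumes "distinct xs"
  shows "bij_betw (\<lambda>j. xs ! (j - 1)) {1..length xs} (set xs)"
proof -
  have "bij_betw ((!) xs \<circ> (\<lambda>j. j - 1)) {1..length xs} (set xs)"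
  proof (rule bij_betw_trans)
    show "bij_betw (\<lambda>j. j - 1) {1..length xs} {..<length xs}"
      by (rule bij_betw_byWitness[where f' = Suc]) auto
    show "bij_betw ((!) xs) {..<length xs} (set xs)"
      using assms by (intro bij_betw_nth) auto
  qed
  then show ?thesis by (simp add: comp_def)
qed

lemma map_nth_pred: "map (\<lambda>j. xs ! (j - 1)) [1..<Suc (length xs)] = xs"
  by (rule nth_equalityI) auto

lemma list_ordering_imp_node_ordering:
  assumes "list_ordering G xs"
  shows "node_ordering G (\<lambda>j. xs ! (j - 1))" "fill_in G (\<lambda>j. xs ! (j - 1)) = fill_list G xs"
proof -
  have n: "card (verts G) = length xs"
    using assms distinct_card unfolding list_ordering_def by metis
  show "node_ordering G (\<lambda>j. xs ! (j - 1))"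
    using bij_betw_nth_pred[of xs] assms unfolding node_ordering_def n list_ordering_def by simp
  show "fill_in G (\<lambda>j. xs ! (j - 1)) = fill_list G xs"
    unfolding fill_in_eq_fill_list n map_nth_pred ..
qed

lemma node_ordering_imp_list_ordering:
  assumes "node_ordering G \<sigma>"
  shows "list_ordering G (map \<sigma> [1..<Suc (card (verts G))])"
  using assms unfolding list_ordering_def node_ordering_def bij_betw_def
  by (auto simp: distinct_map atLeastLessThanSuc_atLeastAtMost)

lemma min_fill_in_le_fill_list:
  assumes "finite_simple_graph G" "list_ordering G xs"
  shows "min_fill_in G \<le> fill_list G xs"
  using min_fill_in_le[of G] list_ordering_imp_node_ordering[OF assms(2)] assms(1)
  by (metis finite_simple_graph_def)

lemma min_fill_in_list_attained:
  assumes "finite_simple_graph G"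
  obtains xs where "list_ordering G xs" "fill_list G xs = min_fill_in G"
proof -
  obtain \<sigma> where "node_ordering G \<sigma>" "fill_in G \<sigma> = min_fill_in G"
    using min_fill_in_attained assms by (metis finite_simple_graph_def)
  then show thesis
    using that node_ordering_imp_list_ordering fill_in_eq_fill_list by metis
qed

section \<open>Perfect elimination orderings and chordal graphs\<close>

definition clique :: "'a ugraph \<Rightarrow> 'a set \<Rightarrow> bool" where
  "clique G K \<longleftrightarrow> (\<forall>c\<in>K. \<forall>d\<in>K. c \<noteq> d \<longrightarrow> {c, d} \<in> edges G)"

definition simplicial_in :: "'a ugraph \<Rightarrow> 'a set \<Rightarrow> 'a \<Rightarrow> bool" where
  "simplicial_in G V x \<longleftrightarrow> clique G (nbhd G x \<inter> V)"

text \<open>The list may enumerate only some of the vertices: it is then a perfect elimination ordering of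
  the subgraph that they induce.\<close>

fun perfect_elimination :: "'a ugraph \<Rightarrow> 'a list \<Rightarrow> bool" where
  "perfect_elimination G [] \<longleftrightarrow> True"
| "perfect_elimination G (x # xs) \<longleftrightarrow>
     x \<notin> set xs \<and> simplicial_in G (set xs) x \<and> perfect_elimination G xs"

definition chordal :: "'a ugraph \<Rightarrow> bool" where
  "chordal G \<longleftrightarrow> finite_simple_graph G \<and> (\<exists>xs. set xs = verts G \<and> perfect_elimination G xs)"

lemma clique_subset: "clique G K \<Longrightarrow> L \<subseteq> K \<Longrightarrow> clique G L"
  by (auto simp: clique_def)

lemma clique_edge: "{u, v} \<in> edges G \<Longrightarrow> clique G {u, v}"
  by (simp add: clique_def insert_commute)

lemma simplicial_in_subset: "simplicial_in G V x \<Longrightarrow> U \<subseteq> V \<Longrightarrow> simplicial_in G U x"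
  unfolding simplicial_in_def by (rule clique_subset) auto

lemma simplicial_inD:
  assumes "simplicial_in G V x" "c \<in> V" "d \<in> V" "{c, x} \<in> edges G" "{d, x} \<in> edges G" "c \<noteq> d"
  shows "{c, d} \<in> edges G"
  using assms by (auto simp: simplicial_in_def clique_def mem_nbhd_iff)

lemma perfect_elimination_distinct: "perfect_elimination G xs \<Longrightarrow> distinct xs"
  by (induction xs) auto

lemma perfect_elimination_filter:
  "perfect_elimination G xs \<Longrightarrow> perfect_elimination G (filter Q xs)"
  by (induction xs) (auto intro: simplicial_in_subset)

lemma perfect_elimination_clique:
  "clique G (set xs) \<Longrightarrow> distinct xs \<Longrightarrow> perfect_elimination G xs"
  by (induction xs) (auto simp: simplicial_in_def intro: clique_subset)

lemma perfect_elimination_cong: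
  assumes "edges_within G (set xs) = edges_within H (set xs)"
  shows "perfect_elimination G xs \<longleftrightarrow> perfect_elimination H xs"
proof -
  have adj: "{c, d} \<in> edges G \<longleftrightarrow> {c, d} \<in> edges H" if "c \<in> set xs" "d \<in> set xs" for c d
    using assms that by (auto simp: edges_within_def set_eq_iff)
  have "simplicial_in G U x \<longleftrightarrow> simplicial_in H U x" if "insert x U \<subseteq> set xs" for x U
    using adj that unfolding simplicial_in_def clique_def by (auto simp: mem_nbhd_iff subset_iff)
  then have "perfect_elimination G ys \<longleftrightarrow> perfect_elimination H ys" if "set ys \<subseteq> set xs" for ys
    using that by (induction ys) auto
  then show ?thesis by blast
qed

lemma perfect_elimination_append:
  assumes "perfect_elimination G (xs @ ks)" "perfect_elimination G (ks @ ys)"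
    and "set xs \<inter> set ys = {}"
    and "\<And>x. x \<in> set xs \<Longrightarrow> nbhd G x \<inter> set ys = {}"
  shows "perfect_elimination G (xs @ ks @ ys)"
  using assms
proof (induction xs)
  case (Cons x xs)
  have "nbhd G x \<inter> set (xs @ ks @ ys) = nbhd G x \<inter> set (xs @ ks)"
    using Cons.prems(4)[of x] by auto
  then have "simplicial_in G (set (xs @ ks @ ys)) x"
    using Cons.prems(1) by (simp add: simplicial_in_def)
  then show ?case using Cons by auto
qed simp

lemma simplicial_outside_clique:
  assumes "finite_simple_graph G" "perfect_elimination G xs" "clique G K" "K \<subset> set xs"
  shows "\<exists>x\<in>set xs - K. simplicial_in G (set xs) x"
  using assms(2-)
proof (induction xs arbitrary: K)
  case (Cons z xs)
  have z: "simplicial_in G (set xs) z" using Cons.prems by simp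
  let ?N = "nbhd G z \<inter> set xs"
  have nbhd_z: "nbhd G z \<inter> set (z # xs) = ?N"
    using nbhd_irrefl[OF assms(1)] by auto
  consider (outside) "z \<notin> K" | (universal) "z \<in> K" "?N = set xs"
    | (proper) "z \<in> K" "?N \<subset> set xs" by blast
  then show ?case
  proof cases
    case outside
    have "simplicial_in G (set (z # xs)) z"
      using z unfolding simplicial_in_def nbhd_z .
    then show ?thesis using outside by auto
  next
    case universal
    then have "clique G (set xs)" "\<forall>x\<in>set xs. {x, z} \<in> edges G"
      using z by (auto simp: simplicial_in_def mem_nbhd_iff)
    then have "clique G (set (z # xs))" by (auto simp: clique_def insert_commute)
    then show ?thesis
      using Cons.prems(3) clique_subset unfolding simplicial_in_def by blast
  next
    case proper
    then obtain x where x: "x \<in> set xs - ?N" "simplicial_in G (set xs) x"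
      using Cons.IH[of ?N] Cons.prems(1) z by (auto simp: simplicial_in_def)
    have "K - {z} \<subseteq> ?N"
      using Cons.prems(2,3) proper(1) by (fastforce simp: clique_def mem_nbhd_iff)
    moreover have "x \<noteq> z" using x Cons.prems(1) by auto
    moreover have "nbhd G x \<inter> set (z # xs) = nbhd G x \<inter> set xs"
      using x(1) nbhd_commute[of x G z] by auto
    then have "simplicial_in G (set (z # xs)) x"
      using x(2) by (simp add: simplicial_in_def)
    ultimately show ?thesis using x(1) by auto
  qed
qed simp

lemma perfect_elimination_ending_in_clique:
  assumes "finite_simple_graph G" "perfect_elimination G xs"
    and "clique G (set ks)" "distinct ks" "set ks \<subseteq> set xs"
  shows "\<exists>ys. perfect_elimination G (ys @ ks) \<and> set (ys @ ks) = set xs"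
  using assms(2,5)
proof (induction "length xs" arbitrary: xs rule: less_induct)
  case less
  show ?case
  proof (cases "set ks = set xs")
    case True
    then show ?thesis
      using perfect_elimination_clique[OF assms(3,4)] by (intro exI[of _ "[]"]) simp
  next
    case False
    then obtain z where z: "z \<in> set xs" "z \<notin> set ks" "simplicial_in G (set xs) z"
      using simplicial_outside_clique[OF assms(1) less.prems(1) assms(3)] less.prems(2) by blast
    let ?xs = "filter (\<lambda>x. x \<noteq> z) xs"
    have "length ?xs < length xs" using z(1) by (auto intro: length_filter_less)
    then obtain ys where ys: "perfect_elimination G (ys @ ks)" "set (ys @ ks) = set ?xs"
      using less.hyps[of ?xs] less.prems z(2) perfect_elimination_filter by fastforce
    have "simplicial_in G (set (ys @ ks)) z"
      using z(3) by (rule simplicial_in_subset) (use ys(2) in auto)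
    then have "perfect_elimination G ((z # ys) @ ks)" using ys by auto
    moreover have "set ((z # ys) @ ks) = set xs" using ys(2) z(1) by auto
    ultimately show ?thesis by blast
  qed
qed

lemma chordal_perfect_elimination_ending_in_clique:
  assumes "chordal G" "U \<subseteq> verts G" "clique G (set ks)" "distinct ks" "set ks \<subseteq> U"
  obtains ys where "perfect_elimination G (ys @ ks)" "set (ys @ ks) = U"
proof -
  obtain xs where xs: "finite_simple_graph G" "set xs = verts G" "perfect_elimination G xs"
    using assms(1) by (auto simp: chordal_def)
  have "set (filter (\<lambda>x. x \<in> U) xs) = U" using xs(2) assms(2) by auto
  then show thesis
    using perfect_elimination_ending_in_clique[OF xs(1) perfect_elimination_filter[OF xs(3)]]
      assms(3-5) that by metis
qed

lemma chordal_induced_subgraph: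
  assumes "chordal G" "U \<subseteq> verts G"
  shows "chordal (induced_subgraph G U)"
proof -
  obtain xs where xs: "perfect_elimination G xs" "set xs = U"
    using chordal_perfect_elimination_ending_in_clique[OF assms, of "[]"] by (auto simp: clique_def)
  have "perfect_elimination (induced_subgraph G U) xs"
    using xs by (subst perfect_elimination_cong[of _ _ G])
      (auto simp: induced_subgraph_def edges_within_def)
  moreover have "finite_simple_graph (induced_subgraph G U)"
    using assms unfolding chordal_def induced_subgraph_def
    by (intro finite_simple_graph_subgraph[of G]) (auto simp: edges_within_def)
  ultimately show ?thesis using xs(2) by (auto simp: chordal_def induced_subgraph_def)
qed

subsection \<open>Separation and bridges\<close>

text \<open>Connectivity enters only through sets closed under adjacency, never through walks.\<close>

definition separated :: "'a ugraph \<Rightarrow> 'a \<Rightarrow> 'a \<Rightarrow> bool" where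
  "separated G u v \<longleftrightarrow> (\<exists>S\<subseteq>verts G. u \<in> S \<and> v \<notin> S \<and> (\<forall>x\<in>S. nbhd G x \<inter> verts G \<subseteq> S))"

definition bridge :: "'a ugraph \<Rightarrow> 'a \<Rightarrow> 'a \<Rightarrow> bool" where
  "bridge G u v \<longleftrightarrow> separated (verts G, edges G - {{u, v}}) u v"

lemma separated_induced_subgraph_iff:
  "separated (induced_subgraph G V) u v \<longleftrightarrow>
     (\<exists>S\<subseteq>V. u \<in> S \<and> v \<notin> S \<and> (\<forall>x\<in>S. nbhd G x \<inter> V \<subseteq> S))"
proof -
  have "nbhd (induced_subgraph G V) x \<inter> V = nbhd G x \<inter> V" if "x \<in> V" for x
    using that by (auto simp: induced_subgraph_def edges_within_def nbhd_def)
  then have "(\<forall>x\<in>S. nbhd (induced_subgraph G V) x \<inter> V \<subseteq> S) \<longleftrightarrow> (\<forall>x\<in>S. nbhd G x \<inter> V \<subseteq> S)"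
    if "S \<subseteq> V" for S
    using that by (intro ball_cong) auto
  moreover have "verts (induced_subgraph G V) = V" by (simp add: induced_subgraph_def)
  ultimately show ?thesis unfolding separated_def by (intro ex_cong1 conj_cong) simp_all
qed

lemma separated_antimono:
  assumes "separated H u v" "verts G = verts H" "edges G \<subseteq> edges H"
  shows "separated G u v"
proof -
  obtain S where "S \<subseteq> verts G" "u \<in> S" "v \<notin> S" "\<forall>x\<in>S. nbhd H x \<inter> verts G \<subseteq> S"
    using assms(1) unfolding separated_def assms(2) by blast
  then show ?thesis
    using nbhd_mono[OF assms(3)] unfolding separated_def by (intro exI[of _ S]) blast
qed

lemma bridge_antimono:
  assumes "bridge H u v" "verts G = verts H" "edges G \<subseteq> edges H"
  shows "bridge G u v"
  using assms(1) unfolding bridge_def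
  by (rule separated_antimono) (use assms(2,3) in auto)

lemma bridgeE:
  assumes "bridge G u v"
  obtains S where "S \<subseteq> verts G" "u \<in> S" "v \<notin> S"
    "\<And>x y. x \<in> S \<Longrightarrow> y \<in> verts G - S \<Longrightarrow> y \<in> nbhd G x \<Longrightarrow> x = u \<and> y = v"
proof -
  obtain S where S: "S \<subseteq> verts G" "u \<in> S" "v \<notin> S"
    and closed: "\<And>x y. x \<in> S \<Longrightarrow> y \<in> verts G \<Longrightarrow> {y, x} \<in> edges G - {{u, v}} \<Longrightarrow> y \<in> S"
    using assms unfolding bridge_def separated_def nbhd_def fst_conv snd_conv by blast
  have "x = u \<and> y = v" if "x \<in> S" "y \<in> verts G - S" "y \<in> nbhd G x" for x y
  proof -
    have "{y, x} = {u, v}" using closed that unfolding mem_nbhd_iff by blast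
    then show ?thesis using that(1) S(3) by (auto simp: doubleton_eq_iff)
  qed
  then show thesis using that S by blast
qed

lemma separated_insert_simplicial:
  assumes "separated (V, E) u v" "simplicial_in (V, E) V z" "z \<noteq> v"
  shows "separated (insert z V, E) u v"
proof -
  obtain S where S: "S \<subseteq> V" "u \<in> S" "v \<notin> S"
    and closed: "\<And>x y. x \<in> S \<Longrightarrow> y \<in> V \<Longrightarrow> {y, x} \<in> E \<Longrightarrow> y \<in> S"
    using assms(1) unfolding separated_def nbhd_def fst_conv snd_conv by blast
  have one_side: "y \<in> S" if "x \<in> S" "{z, x} \<in> E" "y \<in> V" "{y, z} \<in> E" for x y
  proof (rule ccontr)
    assume "y \<notin> S"
    then have "y \<noteq> x" "{x, z} \<in> E" using that(1,2) by (auto simp: insert_commute)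
    then have "{y, x} \<in> E"
      using simplicial_inD[OF assms(2), of y x] that S(1) by auto
    then show False using closed[OF that(1,3)] \<open>y \<notin> S\<close> by blast
  qed
  show ?thesis
  proof (cases "\<exists>x\<in>S. {z, x} \<in> E")
    case True
    then have "\<forall>x\<in>insert z S. nbhd (insert z V, E) x \<inter> insert z V \<subseteq> insert z S"
      using closed one_side unfolding nbhd_def snd_conv by blast
    then show ?thesis
      using S assms(3) unfolding separated_def by (intro exI[of _ "insert z S"]) auto
  next
    case False
    then have "\<forall>x\<in>S. nbhd (insert z V, E) x \<inter> insert z V \<subseteq> S"
      using closed unfolding nbhd_def snd_conv by blast
    then show ?thesis using S unfolding separated_def by (intro exI[of _ S]) auto
  qed
qed

lemma perfect_elimination_last_edge_bridge:
  assumes "perfect_elimination G (ys @ [u, v])" "nbhd G u \<inter> nbhd G v = {}"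
  shows "separated (set (ys @ [u, v]), edges G - {{u, v}}) u v"
  using assms(1)
proof (induction ys)
  case Nil
  then show ?case
    unfolding separated_def by (intro exI[of _ "{u}"]) (auto simp: nbhd_def insert_commute)
next
  case (Cons z ys)
  let ?V = "set (ys @ [u, v])" and ?E = "edges G - {{u, v}}"
  have "{c, d} \<noteq> {u, v}" if "{c, z} \<in> edges G" "{d, z} \<in> edges G" for c d
    using that assms(2) by (auto simp: doubleton_eq_iff mem_nbhd_iff insert_commute)
  then have "{c, d} \<in> ?E"
    if "c \<in> ?V" "d \<in> ?V" "{c, z} \<in> ?E" "{d, z} \<in> ?E" "c \<noteq> d" for c d
    using simplicial_inD[of G ?V z c d] Cons.prems that by simp
  then have "simplicial_in (?V, ?E) ?V z"
    unfolding simplicial_in_def clique_def nbhd_def snd_conv by blast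
  moreover have "separated (?V, ?E) u v" "z \<noteq> v" using Cons by simp_all
  ultimately have "separated (insert z ?V, ?E) u v" by (intro separated_insert_simplicial)
  then show ?case by simp
qed

lemma chordal_nonbridge_in_triangle:
  assumes "chordal G" "{u, v} \<in> edges G" "\<not> bridge G u v"
  shows "nbhd G u \<inter> nbhd G v \<noteq> {}"
proof
  assume disj: "nbhd G u \<inter> nbhd G v = {}"
  have "u \<in> verts G" "v \<in> verts G" "u \<noteq> v"
    using assms(1) edge_endpoints[OF _ assms(2)] by (simp_all add: chordal_def)
  then obtain ys where ys: "perfect_elimination G (ys @ [u, v])" "set (ys @ [u, v]) = verts G"
    using chordal_perfect_elimination_ending_in_clique[OF assms(1), of "verts G" "[u, v]"]
      clique_edge[OF assms(2)]
    by auto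
  then show False
    using perfect_elimination_last_edge_bridge[OF ys(1) disj] assms(3)
    unfolding bridge_def ys(2) by blast
qed

subsection \<open>Contracting an edge\<close>

definition contract_edge :: "'a ugraph \<Rightarrow> 'a \<Rightarrow> 'a \<Rightarrow> 'a ugraph" where
  "contract_edge G u v =
     (verts G - {v}, edges_within G (verts G - {v}) \<union> (\<lambda>x. {u, x}) ` (nbhd G v - {u}))"

lemma verts_contract_edge [simp]: "verts (contract_edge G u v) = verts G - {v}"
  by (simp add: contract_edge_def)

lemma mem_nbhd_contract_edge_iff:
  assumes "finite_simple_graph G" "c \<noteq> v" "d \<noteq> v" "c \<noteq> d"
  shows "c \<in> nbhd (contract_edge G u v) d \<longleftrightarrow>
    c \<in> nbhd G d \<or> c = u \<and> d \<in> nbhd G v \<or> d = u \<and> c \<in> nbhd G v"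
  using assms edge_endpoints[OF assms(1), of c d] nbhd_irrefl[OF assms(1), of v]
  by (auto simp: mem_nbhd_iff contract_edge_def edges_within_def doubleton_eq_iff)

lemma finite_simple_graph_contract_edge:
  assumes "finite_simple_graph G" "{u, v} \<in> edges G"
  shows "finite_simple_graph (contract_edge G u v)"
proof -
  have "u \<in> verts G - {v}" "nbhd G v \<subseteq> verts G - {v}"
    using edge_endpoints[OF assms(1)] assms(2) nbhd_irrefl[OF assms(1)]
    by (fastforce simp: mem_nbhd_iff)+
  then show ?thesis
    using assms(1) unfolding finite_simple_graph_def contract_edge_def edges_within_def
    by (auto simp: card_insert_if)
qed

lemma simplicial_in_contract_edge:
  assumes "finite_simple_graph G" "simplicial_in G (insert u (insert v V)) z"
    and "v \<notin> insert u V" "z \<notin> insert u (insert v V)"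
  shows "simplicial_in (contract_edge G u v) (insert u V) z"
proof -
  let ?K = "contract_edge G u v"
  have nbhd_K: "c \<in> nbhd ?K d \<longleftrightarrow> c \<in> nbhd G d \<or> c = u \<and> d \<in> nbhd G v \<or> d = u \<and> c \<in> nbhd G v"
    if "c \<noteq> v" "d \<noteq> v" "c \<noteq> d" for c d
    by (rule mem_nbhd_contract_edge_iff[OF assms(1) that])
  have nbhd_z: "c \<in> nbhd G z \<or> c = u \<and> v \<in> nbhd G z"
    if "c \<in> nbhd ?K z" "c \<in> insert u V" for c
  proof -
    have "c \<noteq> v" "z \<noteq> v" "c \<noteq> z" "z \<noteq> u" using that(2) assms(3,4) by auto
    then show ?thesis using nbhd_K[of c z] that(1) nbhd_commute[of z G v] by blast
  qed
  have adj: "c \<in> nbhd G d"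
    if "c \<in> nbhd G z" "d \<in> nbhd G z" "c \<in> V" "d \<in> insert u (insert v V)" "c \<noteq> d" for c d
    using simplicial_inD[OF assms(2), of c d] that by (simp add: mem_nbhd_iff)
  have adj_K: "c \<in> nbhd ?K d"
    if "c \<in> nbhd ?K z" "d \<in> nbhd ?K z" "c \<in> V" "d \<in> insert u V" "c \<noteq> d" "c \<noteq> u" for c d
  proof -
    have neq: "c \<noteq> v" "d \<noteq> v" using that(3,4) assms(3) by auto
    have "c \<in> nbhd G z" using nbhd_z[OF that(1)] that by blast
    then have "c \<in> nbhd G d \<or> d = u \<and> c \<in> nbhd G v"
      using nbhd_z[OF that(2,4)] adj[of c d] adj[of c v] that neq by blast
    then show ?thesis using nbhd_K neq that(5) by blast
  qed
  have "c \<in> nbhd ?K d"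
    if "c \<in> nbhd ?K z" "d \<in> nbhd ?K z" "c \<in> insert u V" "d \<in> insert u V" "c \<noteq> d" for c d
    using adj_K[of c d] adj_K[of d c] nbhd_commute[of c ?K d] that by blast
  then show ?thesis by (auto simp: simplicial_in_def clique_def simp flip: mem_nbhd_iff)
qed

lemma perfect_elimination_contract_edge:
  assumes "finite_simple_graph G" "perfect_elimination G (xs @ [v, u])"
  shows "perfect_elimination (contract_edge G u v) (xs @ [u])"
  using assms(2)
proof (induction xs)
  case Nil
  show ?case by (simp add: simplicial_in_def clique_def)
next
  case (Cons z xs)
  have "set (xs @ [v, u]) = insert u (insert v (set xs))" by auto
  then have "simplicial_in (contract_edge G u v) (insert u (set xs)) z"
    using Cons.prems perfect_elimination_distinct[OF Cons.prems]
    by (intro simplicial_in_contract_edge[OF assms(1)]) auto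
  then show ?case using Cons by auto
qed

lemma chordal_contract_edge:
  assumes "chordal G" "{u, v} \<in> edges G"
  shows "chordal (contract_edge G u v)"
proof -
  have G: "finite_simple_graph G" using assms(1) by (simp add: chordal_def)
  have "u \<in> verts G" "v \<in> verts G" "u \<noteq> v"
    by (fact edge_endpoints[OF G assms(2)])+
  then obtain xs where xs: "perfect_elimination G (xs @ [v, u])" "set (xs @ [v, u]) = verts G"
    using chordal_perfect_elimination_ending_in_clique[OF assms(1), of "verts G" "[v, u]"]
      clique_edge[OF assms(2)]
    by (auto simp: insert_commute)
  have "set (xs @ [u]) = verts G - {v}"
    using xs(2) perfect_elimination_distinct[OF xs(1)] by auto
  then show ?thesis
    using perfect_elimination_contract_edge[OF G xs(1)]
      finite_simple_graph_contract_edge[OF G assms(2)]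
    unfolding chordal_def verts_contract_edge by blast
qed

lemma card_edges_contract_edge_in_triangle:
  assumes "finite_simple_graph G" "{u, v} \<in> edges G" "t \<in> nbhd G u \<inter> nbhd G v"
  shows "card (edges (contract_edge G u v)) + 2 \<le> card (edges G)"
proof -
  let ?N = "nbhd G v" and ?E = "edges_within G (verts G - {v})"
  have "{u, t} \<in> edges G" "t \<noteq> v" "u \<noteq> v"
    using assms(2,3) edge_endpoints(3)[OF assms(1)] by (auto simp: mem_nbhd_iff insert_commute)
  then have "{u, t} \<in> ?E"
    using edge_endpoints[OF assms(1)] by (auto simp: edges_within_def)
  then have "edges (contract_edge G u v) = ?E \<union> (\<lambda>x. {u, x}) ` (?N - {u, t})"
    by (auto simp: contract_edge_def)
  also have "card \<dots> \<le> card ?E + card ((\<lambda>x. {u, x}) ` (?N - {u, t}))"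
    by (rule card_Un_le)
  also have "\<dots> \<le> card ?E + card (?N - {u, t})"
    using finite_nbhd[OF assms(1)] by (simp add: card_image_le)
  finally have "card (edges (contract_edge G u v)) \<le> card ?E + card (?N - {u, t})" .
  moreover have "u \<noteq> t" "{u, t} \<subseteq> ?N"
    using assms nbhd_irrefl[OF assms(1)] by (auto simp: mem_nbhd_iff)
  then have "card (?N - {u, t}) + 2 = card ?N"
    using finite_nbhd[OF assms(1), of v] card_mono[of ?N "{u, t}"]
    by (simp add: card_Diff_subset)
  ultimately show ?thesis using card_edges_remove_vertex[OF assms(1), of v] by simp
qed

section \<open>Minimum fill-in and triangulations\<close>

definition triangulation :: "'a ugraph \<Rightarrow> 'a ugraph \<Rightarrow> bool" where
  "triangulation G H \<longleftrightarrow> chordal H \<and> verts H = verts G \<and> edges G \<subseteq> edges H"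

lemma triangulationD:
  assumes "triangulation G H"
  shows "chordal H" "finite_simple_graph H" "verts H = verts G" "edges G \<subseteq> edges H"
  using assms by (auto simp: triangulation_def chordal_def)

fun filled_graph :: "'a ugraph \<Rightarrow> 'a list \<Rightarrow> 'a ugraph" where
  "filled_graph G [] = G"
| "filled_graph G (x # xs) =
     (verts G, incident_edges G x \<union> edges (filled_graph (eliminate G x) xs))"

lemma verts_filled_graph [simp]: "verts (filled_graph G xs) = verts G"
  by (cases xs) auto

lemma edges_subset_filled_graph:
  "finite_simple_graph G \<Longrightarrow> edges G \<subseteq> edges (filled_graph G xs)"
proof (induction xs arbitrary: G)
  case (Cons x xs)
  have "edges (eliminate G x) \<subseteq> edges (filled_graph (eliminate G x) xs)"
    using Cons by (simp add: finite_simple_graph_eliminate)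
  moreover have "edges G \<subseteq> incident_edges G x \<union> edges (eliminate G x)"
    using Cons.prems
    by (auto simp: edges_eliminate edges_within_def incident_edges_def finite_simple_graph_def)
  ultimately show ?case by auto
qed simp

lemma finite_simple_graph_filled_graph:
  "finite_simple_graph G \<Longrightarrow> finite_simple_graph (filled_graph G xs)"
proof (induction xs arbitrary: G)
  case (Cons x xs)
  then have "finite_simple_graph (filled_graph (eliminate G x) xs)"
    by (simp add: finite_simple_graph_eliminate)
  then show ?case
    using Cons.prems by (auto simp: finite_simple_graph_def incident_edges_def)
qed simp

lemma perfect_elimination_filled_graph:
  assumes "finite_simple_graph G" "list_ordering G xs"
  shows "perfect_elimination (filled_graph G xs) xs"
  using assms
proof (induction xs arbitrary: G)
  case (Cons x xs)
  let ?K = "filled_graph (eliminate G x) xs" and ?H = "filled_graph G (x # xs)"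
  have G': "finite_simple_graph (eliminate G x)"
    using Cons.prems(1) by (rule finite_simple_graph_eliminate)
  have x: "x \<notin> set xs" and xs: "list_ordering (eliminate G x) xs"
    using Cons.prems(2) by (auto simp: list_ordering_def)
  have "edges_within ?H (set xs) = edges_within ?K (set xs)"
    using x by (auto simp: edges_within_def incident_edges_def)
  then have "perfect_elimination ?H xs"
    using Cons.IH[OF G' xs] perfect_elimination_cong by blast
  moreover have nbhd: "nbhd ?H x \<subseteq> nbhd G x"
    using edge_endpoints[OF finite_simple_graph_filled_graph[OF G']]
    by (fastforce simp: mem_nbhd_iff incident_edges_def)
  have "edges G \<union> deficiency G x \<subseteq> edges ?H"
    using edges_subset_filled_graph[OF G', of xs]
      edges_subset_filled_graph[OF Cons.prems(1), of "x # xs"] by (auto simp: edges_eliminate)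
  then have "clique ?H (nbhd ?H x)"
    using nbhd doubleton_mem_deficiency_iff[of _ _ G x] unfolding clique_def by blast
  ultimately show ?case
    using x clique_subset unfolding simplicial_in_def perfect_elimination.simps by blast
qed simp

lemma card_edges_filled_graph:
  "finite_simple_graph G \<Longrightarrow> card (edges (filled_graph G xs)) = card (edges G) + fill_list G xs"
proof (induction xs arbitrary: G)
  case (Cons x xs)
  let ?K = "filled_graph (eliminate G x) xs"
  have K: "finite_simple_graph ?K"
    using Cons.prems by (simp add: finite_simple_graph_eliminate finite_simple_graph_filled_graph)
  have "incident_edges G x \<inter> edges ?K = {}"
    using K by (auto simp: finite_simple_graph_def incident_edges_def)
  then have "card (edges (filled_graph G (x # xs))) = card (incident_edges G x) + card (edges ?K)"
    using finite_edges[OF Cons.prems] finite_edges[OF K]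
    by (simp add: card_Un_disjoint incident_edges_def)
  then show ?case
    using Cons card_edges_eliminate[OF Cons.prems, of x] card_incident_edges[OF Cons.prems, of x]
    by (simp add: finite_simple_graph_eliminate)
qed simp

lemma edges_filled_graph_least:
  assumes "list_ordering G xs" "edges G \<subseteq> edges H" "perfect_elimination H xs"
    "finite_simple_graph G"
  shows "edges (filled_graph G xs) \<subseteq> edges H"
  using assms
proof (induction xs arbitrary: G)
  case (Cons x xs)
  have "nbhd G x \<subseteq> nbhd H x \<inter> set xs"
    using Cons.prems edge_endpoints[OF Cons.prems(4)]
    by (fastforce simp: list_ordering_def mem_nbhd_iff)
  moreover have "clique H (nbhd H x \<inter> set xs)"
    using Cons.prems(3) by (simp add: simplicial_in_def)
  ultimately have "deficiency G x \<subseteq> edges H"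
    by (auto simp: deficiency_def clique_def)
  then have "edges (eliminate G x) \<subseteq> edges H"
    using Cons.prems(2) by (auto simp: edges_eliminate edges_within_def)
  moreover have "list_ordering (eliminate G x) xs"
    using Cons.prems(1) by (auto simp: list_ordering_def)
  ultimately have "edges (filled_graph (eliminate G x) xs) \<subseteq> edges H"
    using Cons.IH[of "eliminate G x"] Cons.prems(3) finite_simple_graph_eliminate[OF Cons.prems(4)]
    by simp
  then show ?case using Cons.prems(2) by (auto simp: incident_edges_def)
qed simp

lemma fill_list_le_perfect_elimination:
  assumes "finite_simple_graph G" "finite_simple_graph H" "edges G \<subseteq> edges H"
    and "set xs = verts G" "perfect_elimination H xs"
  shows "card (edges G) + fill_list G xs \<le> card (edges H)"
proof -
  have "list_ordering G xs"
    using assms(4) perfect_elimination_distinct[OF assms(5)] by (simp add: list_ordering_def)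
  then have "edges (filled_graph G xs) \<subseteq> edges H"
    using assms edges_filled_graph_least by metis
  then show ?thesis
    using card_mono[OF finite_edges[OF assms(2)]] card_edges_filled_graph[OF assms(1)] by metis
qed

lemma min_fill_in_le_triangulation:
  assumes "finite_simple_graph G" "triangulation G H"
  shows "card (edges G) + min_fill_in G \<le> card (edges H)"
proof -
  note H = triangulationD[OF assms(2)]
  obtain xs where xs: "set xs = verts G" "perfect_elimination H xs"
    using assms(2) by (auto simp: triangulation_def chordal_def)
  then have "min_fill_in G \<le> fill_list G xs"
    using perfect_elimination_distinct[OF xs(2)]
    by (intro min_fill_in_le_fill_list[OF assms(1)]) (simp add: list_ordering_def)
  then show ?thesis using fill_list_le_perfect_elimination[OF assms(1) H(2,4) xs] by simp
qed

lemma minimum_triangulation_exists: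
  assumes "finite_simple_graph G"
  obtains H where "triangulation G H" "card (edges H) = card (edges G) + min_fill_in G"
proof -
  obtain xs where xs: "list_ordering G xs" "fill_list G xs = min_fill_in G"
    using min_fill_in_list_attained[OF assms] .
  have "chordal (filled_graph G xs)"
    using perfect_elimination_filled_graph[OF assms xs(1)] xs(1)
      finite_simple_graph_filled_graph[OF assms] by (auto simp: chordal_def list_ordering_def)
  then show thesis
    using that[of "filled_graph G xs"] card_edges_filled_graph[OF assms, of xs] xs(2)
      edges_subset_filled_graph[OF assms] by (auto simp: triangulation_def)
qed

section \<open>Paths of vertices of degree two\<close>

text \<open>The end vertices \<open>u\<close> and \<open>w\<close> may coincide; for the empty path they are unconstrained.\<close>

fun degree_two_path :: "'a ugraph \<Rightarrow> 'a \<Rightarrow> 'a list \<Rightarrow> 'a \<Rightarrow> bool" where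
  "degree_two_path G u [] w \<longleftrightarrow> True"
| "degree_two_path G u (v # vs) w \<longleftrightarrow>
     nbhd G v = {u, hd (vs @ [w])} \<and> u \<notin> set (v # vs) \<and> v \<noteq> w \<and> degree_two_path G v vs w"

lemma degree_two_path_ends_notin:
  assumes "degree_two_path G u vs w"
  shows "u \<notin> set vs" "w \<notin> set vs"
  using assms by (induction vs arbitrary: u) auto

lemma degree_two_path_cong:
  assumes "\<And>x. x \<in> set vs \<Longrightarrow> nbhd G x = nbhd H x"
  shows "degree_two_path G u vs w \<longleftrightarrow> degree_two_path H u vs w"
  using assms by (induction vs arbitrary: u) auto

lemma degree_two_path_nbhd_subset:
  assumes "degree_two_path G u vs w" "x \<in> set vs"
  shows "nbhd G x \<subseteq> {u, w} \<union> set vs"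
  using assms by (induction vs arbitrary: u) (auto simp: hd_append split: if_splits)

lemma degree_two_path_subset_verts:
  assumes "finite_simple_graph G" "degree_two_path G u vs w"
  shows "set vs \<subseteq> verts G"
  using assms(2)
proof (induction vs arbitrary: u)
  case (Cons v vs)
  then have "{u, v} \<in> edges G" by (auto simp flip: mem_nbhd_iff)
  then show ?case using Cons edge_endpoints(2)[OF assms(1)] by auto
qed simp

lemma degree_two_path_map_upt:
  assumes "j \<le> k" "inj_on a {j..k}" "a (Suc k) \<notin> a ` {Suc j..k}"
    and "\<forall>i\<in>{Suc j..k}. nbhd G (a i) = {a (i - 1), a (Suc i)}"
  shows "degree_two_path G (a j) (map a [Suc j..<Suc k]) (a (Suc k))"
  using assms
proof (induction rule: inc_induct)
  case (step j)
  have "degree_two_path G (a (Suc j)) (map a [Suc (Suc j)..<Suc k]) (a (Suc k))"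
    using step.prems by (intro step.IH) (auto intro: inj_on_subset)
  moreover have "hd (map a [Suc (Suc j)..<Suc k] @ [a (Suc k)]) = a (Suc (Suc j))"
    using step.hyps by (cases "Suc j = k") (simp_all add: hd_append hd_map)
  then have "nbhd G (a (Suc j)) = {a j, hd (map a [Suc (Suc j)..<Suc k] @ [a (Suc k)])}"
    using step.prems(3) step.hyps by simp
  moreover have "a j \<notin> a ` {Suc j..k}"
    using inj_onD[OF step.prems(1), of j] step.hyps by fastforce
  then have "a j \<notin> set (a (Suc j) # map a [Suc (Suc j)..<Suc k])"
    using step.hyps by (auto simp: atLeastLessThanSuc_atLeastAtMost)
  moreover have "Suc j \<in> {Suc j..k}" using step.hyps by simp
  then have "a (Suc j) \<noteq> a (Suc k)" using step.prems(2) by (metis imageI)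
  moreover have "map a [Suc j..<Suc k] = a (Suc j) # map a [Suc (Suc j)..<Suc k]"
    using step.hyps by (simp add: upt_conv_Cons)
  ultimately show ?case by (simp only: degree_two_path.simps simp_thms)
qed simp

lemma degree_two_path_eliminate:
  assumes "finite_simple_graph G" "degree_two_path G u (v # vs) w"
  shows "degree_two_path (eliminate G v) u vs w"
proof (cases vs)
  case (Cons b bs)
  have v: "nbhd G v = {u, b}" "v \<noteq> w" "u \<notin> set (v # b # bs)"
    and b: "nbhd G b = {v, hd (bs @ [w])}" "b \<noteq> w" "v \<notin> set (b # bs)"
    and bs: "degree_two_path G b bs w"
    using assms(2) Cons by auto
  have "hd (bs @ [w]) \<noteq> v" using v(2) b(3) by (auto simp: hd_append)
  then have "nbhd (eliminate G v) b = {u, hd (bs @ [w])}"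
    using v b by (auto simp: nbhd_eliminate[OF assms(1)])
  moreover have "nbhd G x = nbhd (eliminate G v) x" if "x \<in> set bs" for x
  proof -
    have "x \<noteq> v" "x \<notin> nbhd G v"
      using that v b(3) degree_two_path_ends_notin(1)[OF bs] by auto
    then show ?thesis using nbhd_commute[of x G v] by (simp add: nbhd_eliminate[OF assms(1)])
  qed
  then have "degree_two_path (eliminate G v) b bs w" using bs degree_two_path_cong by metis
  ultimately show ?thesis using v(3) b(2) Cons by simp
qed simp

lemma degree_two_path_avoids:
  assumes "degree_two_path G u (v # vs) w" "v \<notin> S"
    and "\<And>x. x \<in> set (v # vs) - S \<Longrightarrow> nbhd G x \<inter> S = {}"
  shows "insert w (set vs) \<inter> S = {}"
  using assms
proof (induction vs arbitrary: u v)
  case (Cons b vs)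
  have "nbhd G v \<inter> S = {}" using Cons.prems(2,3) by simp
  then have "b \<notin> S" using Cons.prems(1) by auto
  moreover have "insert w (set vs) \<inter> S = {}"
    by (rule Cons.IH[of v b]) (use Cons.prems \<open>b \<notin> S\<close> in auto)
  ultimately show ?case by auto
qed auto

subsection \<open>Eliminating the path first\<close>

lemma min_fill_in_eliminate_simplicial:
  assumes "finite_simple_graph G" "deficiency G v = {}"
  shows "min_fill_in (eliminate G v) \<le> min_fill_in G"
proof -
  obtain H where H: "triangulation G H" "card (edges H) = card (edges G) + min_fill_in G"
    using minimum_triangulation_exists[OF assms(1)] .
  note simple_H = triangulationD(2)[OF H(1)] and extends = triangulationD(3,4)[OF H(1)]
  let ?K = "induced_subgraph H (verts G - {v})"
  have "triangulation (eliminate G v) ?K"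
    using H(1) assms(2) chordal_induced_subgraph[of H "verts G - {v}"]
    by (auto simp: triangulation_def edges_eliminate induced_subgraph_def edges_within_def)
  moreover have "card (nbhd G v) \<le> card (nbhd H v)"
    by (intro card_mono finite_nbhd simple_H nbhd_mono extends(2))
  ultimately show ?thesis
    using min_fill_in_le_triangulation[OF finite_simple_graph_eliminate[OF assms(1)]] H(2)
      extends(1) card_edges_remove_vertex[OF simple_H, of v] card_edges_eliminate[OF assms(1), of v]
      assms(2)
    by (fastforce simp: induced_subgraph_def)
qed

lemma min_fill_in_eliminate_nonbridge:
  assumes "finite_simple_graph G" "nbhd G v = {u, b}" "\<not> bridge G u v"
    and deficient: "deficiency G v = {{u, b}}" "u \<noteq> b"
  shows "min_fill_in (eliminate G v) < min_fill_in G"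
proof -
  obtain H where H: "triangulation G H" "card (edges H) = card (edges G) + min_fill_in G"
    using minimum_triangulation_exists[OF assms(1)] .
  note chordal_H = triangulationD(1)[OF H(1)] and simple_H = triangulationD(2)[OF H(1)]
    and extends = triangulationD(3,4)[OF H(1)]
  have uv: "{u, v} \<in> edges H" "b \<in> nbhd H v"
    using assms(2) nbhd_mono[OF extends(2), of v] by (auto simp flip: mem_nbhd_iff)
  have "edges (eliminate G v) \<subseteq> edges (contract_edge H u v)"
    using extends uv(2) deficient
    by (auto simp: edges_eliminate contract_edge_def edges_within_def)
  then have "triangulation (eliminate G v) (contract_edge H u v)"
    using chordal_contract_edge[OF chordal_H uv(1)] extends(1) by (simp add: triangulation_def)
  then have "card (edges (eliminate G v)) + min_fill_in (eliminate G v)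
      \<le> card (edges (contract_edge H u v))"
    by (intro min_fill_in_le_triangulation finite_simple_graph_eliminate assms(1))
  moreover have "\<not> bridge H u v"
    using assms(3) extends bridge_antimono by metis
  then obtain t where "t \<in> nbhd H u \<inter> nbhd H v"
    using chordal_nonbridge_in_triangle[OF chordal_H uv(1)] by blast
  then have "card (edges (contract_edge H u v)) + 2 \<le> card (edges H)"
    using card_edges_contract_edge_in_triangle[OF simple_H uv(1)] by blast
  ultimately show ?thesis
    using H(2) card_edges_eliminate[OF assms(1), of v] assms(2) deficient by simp
qed

lemma min_fill_in_eliminate_degree_two:
  assumes "finite_simple_graph G" "nbhd G v = {u, b}" "u \<noteq> b \<Longrightarrow> \<not> bridge G u v"
  shows "card (deficiency G v) + min_fill_in (eliminate G v) \<le> min_fill_in G"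
proof (cases "deficiency G v = {}")
  case True
  then show ?thesis using min_fill_in_eliminate_simplicial[OF assms(1)] by simp
next
  case False
  then have "u \<noteq> b" "deficiency G v = {{u, b}}"
    unfolding deficiency_def assms(2) by (auto simp: insert_commute)
  then show ?thesis using min_fill_in_eliminate_nonbridge[OF assms(1,2)] assms(3) by simp
qed

lemma degree_two_path_first_edge_not_bridge:
  assumes "finite_simple_graph G" "degree_two_path G u (v # vs) w" "u \<noteq> hd (vs @ [w])"
    and "\<not> separated (induced_subgraph G (verts G - set (v # vs))) u w"
  shows "\<not> bridge G u v"
proof
  assume "bridge G u v"
  then obtain S where S: "S \<subseteq> verts G" "u \<in> S" "v \<notin> S"
    and leaving: "\<And>x y. x \<in> S \<Longrightarrow> y \<in> verts G - S \<Longrightarrow> y \<in> nbhd G x \<Longrightarrow> x = u \<and> y = v"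
    using bridgeE by metis
  have in_verts: "set (v # vs) \<subseteq> verts G" "v \<notin> set vs" and "nbhd G v = {u, hd (vs @ [w])}"
    using degree_two_path_subset_verts[OF assms(1,2)] assms(2)
      degree_two_path_ends_notin(1)[of G v vs w] by auto
  then have next_notin: "hd (vs @ [w]) \<notin> S"
    using leaving[of "hd (vs @ [w])" v] nbhd_commute[of _ G v] assms(3) S(3) by auto
  have "insert w (set vs) \<inter> S = {}"
  proof (cases vs)
    case Nil
    then show ?thesis using next_notin by simp
  next
    case (Cons b bs)
    have "nbhd G x \<inter> S = {}" if "x \<in> set (b # bs) - S" for x
      using leaving[of _ x] nbhd_commute[of _ G x] that in_verts unfolding Cons by fastforce
    moreover have "degree_two_path G v (b # bs) w" "b \<notin> S"
      using assms(2) next_notin Cons by simp_all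
    ultimately show ?thesis using degree_two_path_avoids[of G v b bs w S] Cons by simp
  qed
  moreover have "nbhd G x \<inter> (verts G - set (v # vs)) \<subseteq> S" if "x \<in> S" for x
    using leaving[OF that] by auto
  ultimately have "separated (induced_subgraph G (verts G - set (v # vs))) u w"
    using S unfolding separated_induced_subgraph_iff by (intro exI[of _ S]) auto
  then show False using assms(4) by contradiction
qed

lemma degree_two_path_first_optimal:
  assumes "finite_simple_graph G" "degree_two_path G u vs w"
    and "\<not> separated (induced_subgraph G (verts G - set vs)) u w"
  shows "\<exists>ys. list_ordering G (vs @ ys) \<and> fill_list G (vs @ ys) = min_fill_in G"
  using assms
proof (induction vs arbitrary: G)
  case Nil
  then show ?case by (metis append_Nil min_fill_in_list_attained)
next
  case (Cons v vs)
  let ?G = "eliminate G v"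
  have G': "finite_simple_graph ?G" using Cons.prems(1) by (rule finite_simple_graph_eliminate)
  have "\<not> separated (induced_subgraph ?G (verts ?G - set vs)) u w"
  proof
    assume "separated (induced_subgraph ?G (verts ?G - set vs)) u w"
    then have "separated (induced_subgraph G (verts G - set (v # vs))) u w"
      by (rule separated_antimono)
        (auto simp: induced_subgraph_def edges_eliminate edges_within_def)
    then show False using Cons.prems(3) by contradiction
  qed
  then obtain ys where ys: "list_ordering ?G (vs @ ys)" "fill_list ?G (vs @ ys) = min_fill_in ?G"
    using Cons.IH[OF G' degree_two_path_eliminate[OF Cons.prems(1,2)]] by blast
  have ordering: "list_ordering G ((v # vs) @ ys)"
    using ys(1) degree_two_path_subset_verts[OF Cons.prems(1,2)] by (auto simp: list_ordering_def)
  have "nbhd G v = {u, hd (vs @ [w])}" using Cons.prems(2) by simp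
  then have "card (deficiency G v) + min_fill_in ?G \<le> min_fill_in G"
    using min_fill_in_eliminate_degree_two[OF Cons.prems(1)]
      degree_two_path_first_edge_not_bridge[OF Cons.prems(1,2) _ Cons.prems(3)] by blast
  then show ?case
    using ordering min_fill_in_le_fill_list[OF Cons.prems(1) ordering] ys(2)
    by (intro exI[of _ ys]) simp
qed

subsection \<open>Eliminating the path in between\<close>

lemma perfect_elimination_degree_two_path_append:
  assumes "degree_two_path G u vs w" "perfect_elimination G ys" "set (u # vs) \<inter> set ys = {}"
  shows "perfect_elimination G (vs @ ys)"
  using assms
proof (induction vs arbitrary: u)
  case (Cons v vs)
  have "nbhd G v \<inter> set (vs @ ys) \<subseteq> {hd (vs @ [w])}" using Cons.prems by auto
  then have "simplicial_in G (set (vs @ ys)) v" by (auto simp: simplicial_in_def clique_def)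
  then show ?case
    using Cons.IH[of v] Cons.prems degree_two_path_ends_notin(1)[of G v vs w] by auto
qed simp

lemma simplicial_in_degree_two_path_start:
  assumes "degree_two_path G u vs w" "u \<noteq> w" "nbhd G u \<inter> set ys = {}"
  shows "simplicial_in G (set (vs @ ys)) u"
proof (cases vs)
  case Nil
  then show ?thesis using assms(3) by (simp add: simplicial_in_def clique_def)
next
  case (Cons b bs)
  then have "u \<notin> nbhd G x" if "x \<in> set bs" for x
    using degree_two_path_nbhd_subset[of G b bs w x] assms(1,2) that by auto
  then have "nbhd G u \<inter> set (vs @ ys) \<subseteq> {b}"
    using assms(3) nbhd_commute[of u G] Cons by auto
  then show ?thesis by (auto simp: simplicial_in_def clique_def)
qed

lemma perfect_elimination_join_degree_two_path:
  assumes path: "degree_two_path G u vs w"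
    and "perfect_elimination G (xs @ [u])" "perfect_elimination G ys"
    and "w \<notin> set (xs @ [u])" "set vs \<inter> (set (xs @ [u]) \<union> set ys) = {}"
    and "set (xs @ [u]) \<inter> set ys = {}"
    and nonadjacent: "\<And>x. x \<in> set (xs @ [u]) \<Longrightarrow> nbhd G x \<inter> set ys = {}"
  shows "perfect_elimination G (xs @ [u] @ vs @ ys)"
proof (rule perfect_elimination_append)
  have "simplicial_in G (set (vs @ ys)) u"
    using assms(4) nonadjacent by (intro simplicial_in_degree_two_path_start[OF path]) auto
  moreover have "perfect_elimination G (vs @ ys)"
    using assms(5,6) by (intro perfect_elimination_degree_two_path_append[OF path assms(3)]) auto
  ultimately show "perfect_elimination G ([u] @ vs @ ys)"
    using assms(6) degree_two_path_ends_notin(1)[OF path] by auto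
  show "nbhd G x \<inter> set (vs @ ys) = {}" if x: "x \<in> set xs" for x
  proof -
    have "x \<notin> {u, w} \<union> set vs"
      using x assms(4,5) perfect_elimination_distinct[OF assms(2)] by auto
    then have "nbhd G x \<inter> set vs = {}"
      using degree_two_path_nbhd_subset[OF path] nbhd_commute[of x G] by auto
    then show ?thesis using nonadjacent[of x] x by auto
  qed
qed (use assms in auto)

lemma triangulation_with_degree_two_path_between:
  assumes G: "finite_simple_graph G" and H: "triangulation G H"
    and path: "degree_two_path G u vs w"
    and "separated (induced_subgraph G (verts G - set vs)) u w"
  obtains K xs ys where "finite_simple_graph K" "edges G \<subseteq> edges K" "edges K \<subseteq> edges H"
    "set (xs @ vs @ ys) = verts G" "perfect_elimination K (xs @ vs @ ys)"
proof -
  obtain U where U: "U \<subseteq> verts G - set vs" "u \<in> U" "w \<notin> U"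
    "\<And>x. x \<in> U \<Longrightarrow> nbhd G x \<inter> (verts G - set vs) \<subseteq> U"
    using assms(4) unfolding separated_induced_subgraph_iff by blast
  define W where "W = verts G - set vs - U"
  define K where "K = (verts G, {e \<in> edges H. e \<in> edges G \<or> e \<subseteq> U \<or> e \<subseteq> W})"
  obtain xs where xs: "perfect_elimination H (xs @ [u])" "set (xs @ [u]) = U"
    using chordal_perfect_elimination_ending_in_clique[of H U "[u]"] triangulationD(1,3)[OF H]
      U(1,2) by (auto simp: clique_def)
  obtain ys where ys: "perfect_elimination H ys" "set ys = W"
    using chordal_perfect_elimination_ending_in_clique[of H W "[]"] triangulationD(1,3)[OF H]
    by (auto simp: W_def clique_def)
  have "perfect_elimination K (xs @ [u] @ vs @ ys)"
  proof (rule perfect_elimination_join_degree_two_path)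
    have "nbhd K x = nbhd G x" if "x \<in> set vs" for x
      using that U(1) triangulationD(4)[OF H] by (auto simp: K_def W_def mem_nbhd_iff)
    then show "degree_two_path K u vs w" using path degree_two_path_cong by metis
    show "perfect_elimination K (xs @ [u])"
      using xs perfect_elimination_cong[of K "xs @ [u]" H] by (auto simp: K_def edges_within_def)
    show "perfect_elimination K ys"
      using ys perfect_elimination_cong[of K ys H] by (auto simp: K_def edges_within_def)
    show "nbhd K x \<inter> set ys = {}" if "x \<in> set (xs @ [u])" for x
      using U(4)[of x] that unfolding xs(2) ys(2) by (auto simp: K_def W_def nbhd_def)
    show "w \<notin> set (xs @ [u])" using U(3) unfolding xs(2) .
    show "set vs \<inter> (set (xs @ [u]) \<union> set ys) = {}" "set (xs @ [u]) \<inter> set ys = {}"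
      using U(1) unfolding xs(2) ys(2) W_def by blast+
  qed
  moreover have "finite_simple_graph K" "edges G \<subseteq> edges K" "edges K \<subseteq> edges H"
    using triangulationD(2-4)[OF H] by (auto simp: K_def finite_simple_graph_def)
  moreover have "set (xs @ [u] @ vs @ ys) = verts G"
    using xs(2) ys(2) U(1) degree_two_path_subset_verts[OF G path] by (auto simp: W_def)
  ultimately show thesis using that[of K "xs @ [u]" ys] by simp
qed

lemma degree_two_path_between_optimal:
  assumes G: "finite_simple_graph G" and path: "degree_two_path G u vs w"
    and separated: "separated (induced_subgraph G (verts G - set vs)) u w"
  shows "\<exists>xs ys. list_ordering G (xs @ vs @ ys) \<and> fill_list G (xs @ vs @ ys) = min_fill_in G"
proof -
  obtain H where H: "triangulation G H" "card (edges H) = card (edges G) + min_fill_in G"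
    using minimum_triangulation_exists[OF G] .
  obtain K xs ys where K: "finite_simple_graph K" "edges G \<subseteq> edges K" "edges K \<subseteq> edges H"
    and order: "set (xs @ vs @ ys) = verts G" "perfect_elimination K (xs @ vs @ ys)"
    using triangulation_with_degree_two_path_between[OF G H(1) path separated] .
  have ordering: "list_ordering G (xs @ vs @ ys)"
    using order(1) perfect_elimination_distinct[OF order(2)] by (simp add: list_ordering_def)
  have "card (edges G) + fill_list G (xs @ vs @ ys) \<le> card (edges K)"
    by (rule fill_list_le_perfect_elimination[OF G K(1,2) order])
  also have "\<dots> \<le> card (edges H)"
    using K(3) finite_edges[OF triangulationD(2)[OF H(1)]] by (rule card_mono[rotated])
  finally have "fill_list G (xs @ vs @ ys) = min_fill_in G"
    using min_fill_in_le_fill_list[OF G ordering] H(2) by simp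
  then show ?thesis using ordering by blast
qed

lemma list_ordering_block_imp_node_ordering:
  assumes "list_ordering G (xs @ map a [1..<Suc k] @ ys)"
  shows "\<exists>\<sigma> x l i. bij_betw x {1..l} (verts G - a ` {1..k}) \<and> i \<le> l \<and> node_ordering G \<sigma> \<and>
    (\<forall>j\<in>{1..i}. \<sigma> j = x j) \<and> (\<forall>j\<in>{1..k}. \<sigma> (i + j) = a j) \<and>
    (\<forall>j\<in>{i + 1..l}. \<sigma> (k + j) = x j) \<and>
    fill_in G \<sigma> = fill_list G (xs @ map a [1..<Suc k] @ ys)"
proof -
  let ?L = "xs @ map a [1..<Suc k] @ ys"
  let ?\<sigma> = "\<lambda>j. ?L ! (j - 1)" and ?x = "\<lambda>j. (xs @ ys) ! (j - 1)"
  have "set (map a [1..<Suc k]) = a ` {1..k}"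
    by (simp add: atLeastLessThanSuc_atLeastAtMost)
  then have "distinct (xs @ ys)" "set (xs @ ys) = verts G - a ` {1..k}"
    using assms unfolding list_ordering_def distinct_append set_append by auto
  then have "bij_betw ?x {1..length (xs @ ys)} (verts G - a ` {1..k})"
    using bij_betw_nth_pred by metis
  moreover have "\<forall>j\<in>{1..length xs}. ?\<sigma> j = ?x j"
    "\<forall>j\<in>{1..k}. ?\<sigma> (length xs + j) = a j"
    "\<forall>j\<in>{length xs + 1..length (xs @ ys)}. ?\<sigma> (k + j) = ?x j"
    by (auto simp: nth_append)
  moreover have "length xs \<le> length (xs @ ys)" by simp
  ultimately show ?thesis using list_ordering_imp_node_ordering[OF assms] by blast
qed

theorem theorem9:
  fixes G :: "'a ugraph" and P :: "'a set" and a :: "nat \<Rightarrow> 'a" and k :: nat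
  assumes "finite_simple_graph G"
    and "P \<subseteq> verts G"
    and "k \<ge> 1"
    and "inj_on a {1..k}" and "P = a ` {1..k}"
    and "path_graph (induced_subgraph G P)"
    and "\<forall>v\<in>P. degree G v = 2"
    and "nbhd_set G P = {a 0, a (k + 1)}"
    and "\<forall>i\<in>{1..k}. nbhd G (a i) = {a (i - 1), a (i + 1)}"
  shows "\<exists>\<sigma>' x l i.
           bij_betw x {1..l} (verts G - P) \<and> i \<le> l \<and>
           node_ordering G \<sigma>' \<and>
           (\<forall>j\<in>{1..i}. \<sigma>' j = x j) \<and>
           (\<forall>j\<in>{1..k}. \<sigma>' (i + j) = a j) \<and>
           (\<forall>j\<in>{i + 1..l}. \<sigma>' (k + j) = x j) \<and>
           fill_in G \<sigma>' = min_fill_in G"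
proof -
  let ?vs = "map a [1..<Suc k]"
  have ends: "a 0 \<notin> a ` {1..k}" "a (Suc k) \<notin> a ` {1..k}"
    using assms(5,8) by (auto simp: nbhd_set_def)
  have "{0..k} = insert 0 {1..k}" by auto
  then have "inj_on a {0..k}" using assms(4) ends(1) by auto
  then have path: "degree_two_path G (a 0) ?vs (a (Suc k))"
    using degree_two_path_map_upt[of 0 k a G] ends(2) assms(9) by simp
  obtain xs ys where opt: "list_ordering G (xs @ ?vs @ ys)"
    "fill_list G (xs @ ?vs @ ys) = min_fill_in G"
    using degree_two_path_first_optimal[OF assms(1) path]
      degree_two_path_between_optimal[OF assms(1) path] append_Nil by metis
  then show ?thesis
    using list_ordering_block_imp_node_ordering[OF opt(1)] unfolding opt(2) assms(5) by blast
qed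

end
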